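(* For $n\ge3$, let $P^n=[A_1^n,\dots,A_n^n]$ be an $n$-gon and let $B_1^n,\dots,B_n^n$ be points such that for each $i\in\{1,\dots,n\}$, $B_i^n$ lies on $A_i^n\times A_{i+1}^n$. For $m\in\{4,\dots,n\}$, the $m$-gon $P^m=[A_1^m,\dots,A_m^m]$ with points $B_1^m,\dots,B_m^m$ can be reduced in a step to the $(m-1)$-gon $P^{m-1}=[A_1^{m-1},\dots,A_{m-1}^{m-1}]$ with points $B_1^{m-1},\dots,B_{m-1}^{m-1}$ by obeying the following procedure: - Choose a vertex $A_i^m$, $i\in\{1,\dots,m\}$. - Replace $B_{i-1}^m$ and $B_i^m$ by $B_{i-1}^{m-1}=(A_{i-1}^m\times A_{i+1}^m)\times(B_{i-1}^m\times B_i^m)$. - Let $A_j^{m-1}=A_j^m$ for $j\in\{1,\dots,i-1\}$ and $A_j^{m-1}=A_{j+1}^m$ for $j\in\{i,\dots,m-1\}$. - Let $B_j^{m-1}=B_j^m$ for $j\in\{1,\dots,i-2\}$ and $B_j^{m-1}=B_{j+1}^m$ for $j\in\{i,\dots,m-1\}$. If it is possible to reduce $P^n$ in $n-3$ steps to a triangle $P^3$ for which $B_1^3,B_2^3,B_3^3$ are collinear, then every sequence of $n-3$ steps will lead to such a triangle. Furthermore, this is the case if and only if $$\frac{A_1^nB_1^n}{B_1^nA_2^n}\cdot\frac{A_2^nB_2^n}{B_2^nA_3^n}\cdot\ldots\cdot\frac{A_n^nB_n^n}{B_n^nA_1^n}=(-1)^n.$$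
   Context: $A\times B$ denotes the line through the points $A$ and $B$, and $g\times h$ the intersection point of the lines $g$ and $h$. For collinear points, $\frac{AB}{CD}$ is the quotient of the oriented lengths of the segments $AB$ and $CD$ on an oriented line. Indices are taken cyclically (modulo $m$ for an $m$-gon). If $i=1$ is chosen, the vertex $A_1^m$ is removed, the points $B_m^m,B_1^m$ are replaced by the single point $(A_m^m\times A_2^m)\times(B_m^m\times B_1^m)$ on the new side $A_m^m\times A_2^m$, and all other vertices and points keep their cyclic order, labelled so that again $B_j^{m-1}$ lies on $A_j^{m-1}\times A_{j+1}^{m-1}$.
   Formalization: The equivalence is stated assuming some sequence of n−3 steps can be carried out (for a square with side midpoints the product is 1 but all steps meet parallel lines); polygons and triangles reached are not collinear, and B_i ≠ A_{i+1}. *)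

theory Defs
  imports "HOL-Analysis.Analysis"
begin

text \<open>Vertices and points are indexed by \<open>1, \<dots>, m\<close>, cyclically; values of the indexing
  functions outside this range are irrelevant.\<close>

type_synonym points = "nat \<Rightarrow> real^2"

definition cyc_succ :: "nat \<Rightarrow> nat \<Rightarrow> nat" where
  "cyc_succ m i = (if i = m then 1 else i + 1)"

definition cyc_pred :: "nat \<Rightarrow> nat \<Rightarrow> nat" where
  "cyc_pred m i = (if i = 1 then m else i - 1)"

text \<open>The sides have to span lines, and a polygon does not lie on a single line. For \<open>m = 3\<close> this
  says that the triangle is non-degenerate; repeated or collinear vertices, self-intersections and
  non-convexity are allowed otherwise.\<close>

definition polygon :: "nat \<Rightarrow> points \<Rightarrow> bool" where
  "polygon m A \<longleftrightarrow> 3 \<le> m \<and> (\<forall>i\<in>{1..m}. A i \<noteq> A (cyc_succ m i)) \<and> \<not> collinear (A ` {1..m})"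

definition line_through :: "real^2 \<Rightarrow> real^2 \<Rightarrow> (real^2) set" where
  "line_through P Q = affine hull {P, Q}"

text \<open>\<open>X\<close> is the intersection point of the lines \<open>PQ\<close> and \<open>RS\<close>: both lines are
  determined by their points, and they are neither parallel nor equal.\<close>

definition lines_meet_at :: "real^2 \<Rightarrow> real^2 \<Rightarrow> real^2 \<Rightarrow> real^2 \<Rightarrow> real^2 \<Rightarrow> bool" where
  "lines_meet_at P Q R S X \<longleftrightarrow>
     P \<noteq> Q \<and> R \<noteq> S \<and> line_through P Q \<inter> line_through R S = {X}"

definition delete_vertex :: "nat \<Rightarrow> points \<Rightarrow> points" where
  "delete_vertex i A = (\<lambda>j. if j < i then A j else A (j + 1))"

text \<open>The new point \<open>X\<close> lies on the side joining the two neighbours of the deleted vertex, which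
  is side \<open>i - 1\<close> of the new \<open>(m - 1)\<close>-gon; for \<open>i = 1\<close> this is its last side, number \<open>m - 1\<close>.\<close>

definition merge_points :: "nat \<Rightarrow> nat \<Rightarrow> real^2 \<Rightarrow> points \<Rightarrow> points" where
  "merge_points m i X B =
     (\<lambda>j. if j = cyc_pred (m - 1) i then X else if j < i then B j else B (j + 1))"

inductive reduction_step :: "nat \<times> points \<times> points \<Rightarrow> nat \<times> points \<times> points \<Rightarrow> bool" where
  "\<lbrakk>4 \<le> m; i \<in> {1..m};
    lines_meet_at (A (cyc_pred m i)) (A (cyc_succ m i)) (B (cyc_pred m i)) (B i) X;
    polygon (m - 1) (delete_vertex i A)\<rbrakk>
   \<Longrightarrow> reduction_step (m, A, B) (m - 1, delete_vertex i A, merge_points m i X B)"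

definition collinear_triangle :: "nat \<times> points \<times> points \<Rightarrow> bool" where
  "collinear_triangle = (\<lambda>(m, A, B). m = 3 \<and> polygon 3 A \<and> collinear {B 1, B 2, B 3})"

definition oriented_length :: "real^2 \<Rightarrow> real^2 \<Rightarrow> real^2 \<Rightarrow> real" where
  "oriented_length u P Q = (Q - P) \<bullet> u"

text \<open>Quotient \<open>PQ/RS\<close> of oriented lengths for collinear points with \<open>R \<noteq> S\<close>. The common line is
  oriented from \<open>R\<close> to \<open>S\<close>; by the lemma below the orientation does not matter.\<close>

definition oriented_quotient :: "real^2 \<Rightarrow> real^2 \<Rightarrow> real^2 \<Rightarrow> real^2 \<Rightarrow> real" where
  "oriented_quotient P Q R S =
     oriented_length (sgn (S - R)) P Q / oriented_length (sgn (S - R)) R S"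

lemma oriented_quotient_any_orientation:
  assumes "norm u = 1" "Q - P = p *\<^sub>R u" "S - R = s *\<^sub>R u" "R \<noteq> S"
  shows "oriented_quotient P Q R S = oriented_length u P Q / oriented_length u R S"
proof -
  have "u \<bullet> u = 1" using assms(1) by (simp add: norm_eq_1)
  moreover have "s \<noteq> 0" using assms(3,4) by auto
  ultimately show ?thesis
    using assms(1) by (simp add: oriented_quotient_def oriented_length_def assms(2,3) sgn_div_norm)
qed

end

theory Submission imports Defs begin

text \<open>By Menelaus' theorem for the triangle \<open>A\<^sub>i\<^sub>-\<^sub>1 A\<^sub>i A\<^sub>i\<^sub>+\<^sub>1\<close>, the quotient belonging to the new point
  is minus the product of the two quotients that it replaces, so a step negates the product of all
  quotients. For a triangle, Menelaus' theorem says that the three points are collinear if and only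
  if the product is \<open>-1 = (-1)\<^sup>3\<close>. A step at a vertex whose neighbouring sides lie on a common line
  is impossible, because the two lines to be intersected would then coincide.\<close>

section \<open>Oriented quotients and affine coordinates\<close>

lemma oriented_quotient_param:
  assumes "X = P + x *\<^sub>R (Q - P)" "X \<noteq> Q"
  shows "oriented_quotient P X X Q = x / (1 - x)"
proof -
  have d: "Q - X = (1 - x) *\<^sub>R (Q - P)" "X - P = x *\<^sub>R (Q - P)"
    using assms(1) by (simp_all add: algebra_simps)
  have "Q \<noteq> P" "x \<noteq> 1" using d(1) assms by auto
  \<comment> \<open>By definition the line is oriented from \<open>X\<close> to \<open>Q\<close>,
    which reverses once \<open>x > 1\<close>. Orienting by \<open>Q - P\<close> instead treats all
    positions of \<open>X\<close> at once.\<close>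
  then show ?thesis
    using assms(2)
      oriented_quotient_any_orientation
        [of "sgn (Q - P)" X P "x * norm (Q - P)" Q X "(1 - x) * norm (Q - P)"]
    by (simp add: d oriented_length_def norm_sgn sgn_div_norm dot_square_norm)
qed

lemma line_through_param:
  "X \<in> line_through P Q \<longleftrightarrow> (\<exists>x. X = P + x *\<^sub>R (Q - P))"
proof
  assume "X \<in> line_through P Q"
  then obtain u v where "X = u *\<^sub>R P + v *\<^sub>R Q" "u + v = 1"
    by (auto simp: line_through_def affine_hull_2)
  then have "X = P + v *\<^sub>R (Q - P)"
    by (simp add: algebra_simps flip: scaleR_add_left)
  then show "\<exists>x. X = P + x *\<^sub>R (Q - P)" ..
next
  assume "\<exists>x. X = P + x *\<^sub>R (Q - P)"
  then obtain x where "X = (1 - x) *\<^sub>R P + x *\<^sub>R Q" by (auto simp: algebra_simps)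
  then show "X \<in> line_through P Q"
    unfolding line_through_def affine_hull_2 by fastforce
qed

text \<open>Non-collinearity makes \<open>V - P\<close> and \<open>Q - P\<close> linearly
  independent. Taking \<open>P\<close> as origin, equations between points thus become pairs of
  scalar equations.\<close>

lemma not_collinear_coeffs_eq:
  fixes P V Q :: "'a::real_vector"
  assumes "\<not> collinear {P, V, Q}"
    and "a *\<^sub>R (V - P) + b *\<^sub>R (Q - P) = c *\<^sub>R (V - P) + d *\<^sub>R (Q - P)"
  shows "a = c \<and> b = d"
proof -
  have zero: "(a - c) *\<^sub>R (V - P) + (b - d) *\<^sub>R (Q - P) = 0"
    using assms(2) by (simp add: algebra_simps)
  have nc: "\<not> collinear {V, P, Q}" using assms(1) by (simp add: insert_commute)
  then have ne: "V - P \<noteq> 0" "Q - P \<noteq> 0" and ndep: "\<And>k. Q - P \<noteq> k *\<^sub>R (V - P)"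
    by (auto simp: collinear_3 collinear_lemma)
  have "b = d"
  proof (rule ccontr)
    assume "b \<noteq> d"
    moreover from zero have "(b - d) *\<^sub>R (Q - P) = (c - a) *\<^sub>R (V - P)"
      by (simp add: algebra_simps)
    ultimately have "Q - P = ((c - a) / (b - d)) *\<^sub>R (V - P)"
      by (metis (no_types, lifting) divide_inverse_commute eq_iff_diff_eq_0 scaleR_scaleR
          scaleR_one left_inverse)
    with ndep show False by blast
  qed
  with zero ne show ?thesis by simp
qed

section \<open>Menelaus' theorem\<close>

lemma lines_meet_at_imp_not_collinear:
  assumes meet: "lines_meet_at P Q Y Z X" and "P \<noteq> V"
    and Y: "Y \<in> line_through P V" and Z: "Z \<in> line_through V Q"
  shows "\<not> collinear {P, V, Q}"
proof
  assume "collinear {P, V, Q}"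
  then have "collinear {V, P, Q}" by (simp add: insert_commute)
  moreover have PQ: "P \<noteq> Q" and YZ: "Y \<noteq> Z"
    and X: "line_through P Q \<inter> line_through Y Z = {X}"
    using meet by (auto simp: lines_meet_at_def)
  ultimately obtain c where c: "Q - P = c *\<^sub>R (V - P)"
    using \<open>P \<noteq> V\<close> by (auto simp: collinear_3 collinear_lemma)
  obtain y z where y: "Y = P + y *\<^sub>R (V - P)" and "Z = V + z *\<^sub>R (Q - V)"
    using Y Z by (auto simp: line_through_param)
  moreover have "V + z *\<^sub>R (Q - V) = P + (1 - z) *\<^sub>R (V - P) + z *\<^sub>R (Q - P)"
    by (simp add: algebra_simps)
  ultimately have "Z = P + (1 - z) *\<^sub>R (V - P) + z *\<^sub>R (Q - P)" by simp
  then have z: "Z = P + (1 - z + z * c) *\<^sub>R (V - P)"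
    by (simp only: c scaleR_scaleR scaleR_add_left add.assoc)
  \<comment> \<open>On the supposed common line, with origin \<open>P\<close> and direction
    \<open>V - P\<close>, the points \<open>Y\<close>, \<open>Z\<close> and \<open>Q\<close> have
    coordinates \<open>y\<close>, \<open>w\<close> and \<open>c\<close>.\<close>
  define w where "w = 1 - z + z * c"
  have "w \<noteq> y" using y z YZ w_def by auto
  \<comment> \<open>Since \<open>w \<noteq> y\<close>, the points \<open>Y\<close> and
    \<open>Z\<close> span the whole common line. The values \<open>0\<close> and \<open>c\<close> of
    \<open>k\<close> then give \<open>P\<close> and \<open>Q\<close>, two distinct points in an
    intersection that is a singleton.\<close>
  have on: "P + k *\<^sub>R (V - P) \<in> line_through Y Z" for k
  proof -
    have "P + k *\<^sub>R (V - P) = Y + ((k - y) / (w - y)) *\<^sub>R (Z - Y)"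
    proof -
      have "Z - Y = (w - y) *\<^sub>R (V - P)" by (simp add: y z w_def algebra_simps)
      then have "((k - y) / (w - y)) *\<^sub>R (Z - Y) = (k - y) *\<^sub>R (V - P)"
        using \<open>w \<noteq> y\<close> by simp
      then show ?thesis by (simp add: y algebra_simps)
    qed
    then show ?thesis by (auto simp: line_through_param)
  qed
  have "P \<in> line_through Y Z" "Q \<in> line_through Y Z"
    using on[of 0] on[of c] by (simp_all flip: c)
  moreover have "P \<in> line_through P Q" "Q \<in> line_through P Q"
    by (simp_all add: line_through_def hull_inc)
  ultimately have "P \<in> {X}" "Q \<in> {X}" unfolding X[symmetric] by auto
  with PQ show False by simp
qed

text \<open>\<open>X\<close> is expressed once on the line \<open>PQ\<close> (parameter
  \<open>x\<close>) and once on the line \<open>YZ\<close> (parameter \<open>w\<close>); comparing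
  coefficients and eliminating \<open>w\<close> ties \<open>x\<close> to \<open>y\<close> and
  \<open>z\<close>. The conclusion \<open>X \<noteq> Q\<close> keeps the new quotient's denominator
  nonzero.\<close>

lemma menelaus_quotient:
  assumes meet: "lines_meet_at P Q Y Z X" and "P \<noteq> V"
    and Y: "Y \<in> line_through P V" "Y \<noteq> V" and Z: "Z \<in> line_through V Q" "Z \<noteq> Q"
  shows "X \<in> line_through P Q" "X \<noteq> Q"
    and "oriented_quotient P X X Q = - (oriented_quotient P Y Y V * oriented_quotient V Z Z Q)"
proof -
  have nc: "\<not> collinear {P, V, Q}"
    using lines_meet_at_imp_not_collinear assms by blast
  have XPQ: "X \<in> line_through P Q" and XYZ: "X \<in> line_through Y Z"
    using meet by (auto simp: lines_meet_at_def)
  obtain x where x: "X = P + x *\<^sub>R (Q - P)" using XPQ line_through_param by blast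
  obtain y where y: "Y = P + y *\<^sub>R (V - P)" using Y(1) line_through_param by blast
  obtain z where z: "Z = V + z *\<^sub>R (Q - V)" using Z(1) line_through_param by blast
  obtain w where w: "X = Y + w *\<^sub>R (Z - Y)" using XYZ line_through_param by blast
  have y1: "y \<noteq> 1" and z1: "z \<noteq> 1" using y z Y Z by auto
  have "0 *\<^sub>R (V - P) + x *\<^sub>R (Q - P)
      = (y + w * (1 - z - y)) *\<^sub>R (V - P) + (w * z) *\<^sub>R (Q - P)"
  proof -
    have "Z - Y = (1 - z - y) *\<^sub>R (V - P) + z *\<^sub>R (Q - P)"
      by (simp add: y z algebra_simps)
    moreover have "x *\<^sub>R (Q - P) = y *\<^sub>R (V - P) + w *\<^sub>R (Z - Y)"
      using x w y by (metis add.assoc add_left_cancel)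
    ultimately show ?thesis by (simp add: scaleR_add_left scaleR_add_right)
  qed
  from not_collinear_coeffs_eq[OF nc this]
  have e1: "y + w * (1 - z - y) = 0" and e2: "x = w * z" by auto
  \<comment> \<open>Eliminating \<open>w\<close> by multiplication avoids a division by
    \<open>1 - z - y\<close>.\<close>
  have "x * (1 - z - y) = w * (1 - z - y) * z" using e2 by (simp add: algebra_simps)
  also have "w * (1 - z - y) = - y" using e1 by simp
  finally have e3: "x * (1 - z - y) = - (y * z)" by simp
  have x1: "x \<noteq> 1"
  proof
    \<comment> \<open>Passing through \<open>Q\<close> would force \<open>Y = V\<close> or
      \<open>Z = Q\<close>.\<close>
    assume "x = 1"
    then have "(1 - y) * (1 - z) = 0" using e3 by (simp add: algebra_simps)
    then show False using y1 z1 by simp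
  qed
  moreover have "Q - X = (1 - x) *\<^sub>R (Q - P)" by (simp add: x algebra_simps)
  moreover have "P \<noteq> Q" using meet by (simp add: lines_meet_at_def)
  ultimately show XQ: "X \<noteq> Q" by auto
  show "X \<in> line_through P Q" by (rule XPQ)
  have "x * ((1 - y) * (1 - z)) = - (y * z) * (1 - x)"
    using e3 by (simp add: algebra_simps)
  then have "x / (1 - x) = - (y * z) / ((1 - y) * (1 - z))"
    using x1 y1 z1 by (simp only: frac_eq_eq mult_eq_0_iff right_minus_eq not_sym simp_thms)
  then have "x / (1 - x) = - (y / (1 - y) * (z / (1 - z)))" by simp
  then show "oriented_quotient P X X Q
      = - (oriented_quotient P Y Y V * oriented_quotient V Z Z Q)"
    using oriented_quotient_param[OF x XQ] oriented_quotient_param[OF y Y(2)]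
      oriented_quotient_param[OF z Z(2)] by simp
qed

text \<open>Collinearity means that two linear equations in one unknown \<open>u\<close> are
  solvable. The first fixes \<open>u\<close>, and clearing denominators in the second gives a
  relation symmetric in \<open>x\<close>, \<open>y\<close>, \<open>z\<close>, which is the product
  formula.\<close>

lemma menelaus_collinear_iff:
  assumes nc: "\<not> collinear {P, V, Q}"
    and X: "X \<in> line_through P V" "X \<noteq> V" and Y: "Y \<in> line_through V Q" "Y \<noteq> Q"
    and Z: "Z \<in> line_through Q P" "Z \<noteq> P"
  shows "collinear {X, Y, Z} \<longleftrightarrow>
    oriented_quotient P X X V * oriented_quotient V Y Y Q * oriented_quotient Q Z Z P = -1"
proof -
  obtain x y z where x: "X = P + x *\<^sub>R (V - P)" and y: "Y = V + y *\<^sub>R (Q - V)"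
    and z: "Z = Q + z *\<^sub>R (P - Q)"
    using X Y Z by (auto simp: line_through_param)
  have ne: "x \<noteq> 1" "y \<noteq> 1" "z \<noteq> 1" using x y z X Y Z by auto
  have y': "Y = P + ((1 - y) *\<^sub>R (V - P) + y *\<^sub>R (Q - P))"
    and z': "Z = P + (0 *\<^sub>R (V - P) + (1 - z) *\<^sub>R (Q - P))"
    by (simp_all add: y z algebra_simps)
  \<comment> \<open>The lines \<open>VQ\<close> and \<open>QP\<close> share only \<open>Q\<close>,
    which \<open>Y\<close> avoids; in coordinates, \<open>1 - y\<close> is nonzero.\<close>
  have "Y \<noteq> Z"
    using not_collinear_coeffs_eq[OF nc, of "1 - y" y 0 "1 - z"] y' z' ne by auto
  have comb: "u *\<^sub>R Y + (1 - u) *\<^sub>R Z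
      = P + ((u * (1 - y)) *\<^sub>R (V - P) + (u * y + (1 - u) * (1 - z)) *\<^sub>R (Q - P))" for u
    by (simp add: y' z' algebra_simps)
  have "collinear {X, Y, Z} \<longleftrightarrow> collinear {Y, X, Z}" by (simp add: insert_commute)
  also have "\<dots> \<longleftrightarrow> (\<exists>u. X = u *\<^sub>R Y + (1 - u) *\<^sub>R Z)"
    using \<open>Y \<noteq> Z\<close> by (simp add: collinear_3_expand)
  also have "\<dots> \<longleftrightarrow> (\<exists>u. x = u * (1 - y) \<and> 0 = u * y + (1 - u) * (1 - z))"
  proof -
    have "X = u *\<^sub>R Y + (1 - u) *\<^sub>R Z \<longleftrightarrow>
        x = u * (1 - y) \<and> 0 = u * y + (1 - u) * (1 - z)" for u
      unfolding comb x
      using not_collinear_coeffs_eq[OF nc, of x 0 "u * (1 - y)" "u * y + (1 - u) * (1 - z)"]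
      by auto
    then show ?thesis by simp
  qed
  also have "\<dots> \<longleftrightarrow> 0 = x / (1 - y) * y + (1 - x / (1 - y)) * (1 - z)"
  proof -
    have "x = u * (1 - y) \<longleftrightarrow> u = x / (1 - y)" for u
      using ne nonzero_eq_divide_eq[of "1 - y" u x] by auto
    then show ?thesis by auto
  qed
  also have "\<dots> \<longleftrightarrow> x * y * z + (1 - x) * (1 - y) * (1 - z) = 0"
  proof -
    \<comment> \<open>\<open>q\<close> is the value forced on \<open>u\<close>; the two sides of the
      equivalence differ by the nonzero factor \<open>1 - y\<close>.\<close>
    define q where "q = x / (1 - y)"
    have "x = q * (1 - y)" using ne by (simp add: q_def)
    then have "x * y * z + (1 - x) * (1 - y) * (1 - z)
        = (q * y + (1 - q) * (1 - z)) * (1 - y)"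
      by algebra
    then show ?thesis using ne unfolding q_def by auto
  qed
  also have "\<dots> \<longleftrightarrow> x / (1 - x) * (y / (1 - y)) * (z / (1 - z)) = -1"
  proof -
    have "x / (1 - x) * (y / (1 - y)) * (z / (1 - z)) = x * y * z / ((1 - x) * (1 - y) * (1 - z))"
      by simp
    moreover have "(1 - x) * (1 - y) * (1 - z) \<noteq> 0" using ne by simp
    ultimately show ?thesis by (simp only: divide_eq_eq if_False) argo
  qed
  finally show ?thesis
    using oriented_quotient_param[OF x X(2)] oriented_quotient_param[OF y Y(2)]
      oriented_quotient_param[OF z Z(2)] by simp
qed

section \<open>Reduction steps and the quotient product\<close>

definition polygon_with_points :: "nat \<times> points \<times> points \<Rightarrow> bool" where
  "polygon_with_points = (\<lambda>(m, A, B). polygon m A \<and>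
     (\<forall>i\<in>{1..m}. B i \<in> line_through (A i) (A (cyc_succ m i)) \<and> B i \<noteq> A (cyc_succ m i)))"

definition quotient_product :: "nat \<times> points \<times> points \<Rightarrow> real" where
  "quotient_product = (\<lambda>(m, A, B).
     \<Prod>i = 1..m. oriented_quotient (A i) (B i) (B i) (A (cyc_succ m i)))"

text \<open>This is the relabelling caused by deleting vertex \<open>i\<close>: a new index is sent
  to the old index of the same vertex.\<close>

definition skip :: "nat \<Rightarrow> nat \<Rightarrow> nat" where
  "skip i j = (if j < i then j else j + 1)"

lemma bij_betw_skip:
  assumes "i \<in> {1..m}"
  shows "bij_betw (skip i) {1..m - 1} ({1..m} - {i})"
  unfolding bij_betw_def
proof
  show "inj_on (skip i) {1..m - 1}" by (auto simp: inj_on_def skip_def split: if_splits)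
  show "skip i ` {1..m - 1} = {1..m} - {i}"
  proof
    show "skip i ` {1..m - 1} \<subseteq> {1..m} - {i}" using assms by (auto simp: skip_def)
    show "{1..m} - {i} \<subseteq> skip i ` {1..m - 1}"
    proof
      fix x assume x: "x \<in> {1..m} - {i}"
      show "x \<in> skip i ` {1..m - 1}"
      proof (rule image_eqI)
        show "x = skip i (if x < i then x else x - 1)" using x by (auto simp: skip_def)
        show "(if x < i then x else x - 1) \<in> {1..m - 1}" using x assms by auto
      qed
    qed
  qed
qed

text \<open>Side \<open>cyc_pred (m - 1) i\<close> of the new polygon is the one joining the
  neighbours of vertex \<open>i\<close>; every other side keeps its endpoints. The wrap-around cases
  \<open>i = 1\<close> and \<open>i = m\<close> are settled here once and for all.\<close>

lemma skip_cyc: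
  assumes "4 \<le> m" "i \<in> {1..m}"
  shows "cyc_pred (m - 1) i \<in> {1..m - 1}"
    and "skip i (cyc_pred (m - 1) i) = cyc_pred m i"
    and "skip i (cyc_succ (m - 1) (cyc_pred (m - 1) i)) = cyc_succ m i"
    and "\<And>j. \<lbrakk>j \<in> {1..m - 1}; j \<noteq> cyc_pred (m - 1) i\<rbrakk> \<Longrightarrow>
      skip i (cyc_succ (m - 1) j) = cyc_succ m (skip i j)"
    and "cyc_succ m (cyc_pred m i) = i"
    and "cyc_pred m i \<in> {1..m}"
  using assms by (auto simp: skip_def cyc_pred_def cyc_succ_def split: if_splits)

lemma reduction_step_invariant:
  assumes "reduction_step S T" "polygon_with_points S"
  shows "polygon_with_points T" "quotient_product T = - quotient_product S" "fst T = fst S - 1"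
proof -
  have "polygon_with_points T \<and> quotient_product T = - quotient_product S \<and> fst T = fst S - 1"
    using assms
  proof cases
    case (1 m i A B X)
    define k where "k = cyc_pred (m - 1) i"
    define p where "p = cyc_pred m i"
    define s where "s = cyc_succ m i"
    define f where "f j = oriented_quotient (A j) (B j) (B j) (A (cyc_succ m j))" for j
    let ?A = "delete_vertex i A" and ?B = "merge_points m i X B"
    define g where "g j = oriented_quotient (?A j) (?B j) (?B j) (?A (cyc_succ (m - 1) j))" for j
    note cyc = skip_cyc[OF 1(3,4), folded k_def p_def s_def]
    have A: "?A j = A (skip i j)" for j by (simp add: delete_vertex_def skip_def)
    have Bk: "?B k = X" and B: "j \<noteq> k \<Longrightarrow> ?B j = B (skip i j)" for j
      by (simp_all add: merge_points_def skip_def k_def)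
    have skip_in: "skip i j \<in> {1..m}" if "j \<in> {1..m - 1}" for j
      using bij_betwE[OF bij_betw_skip[OF 1(4)]] that by blast
    have on: "B j \<in> line_through (A j) (A (cyc_succ m j))" "B j \<noteq> A (cyc_succ m j)"
      "A j \<noteq> A (cyc_succ m j)" if "j \<in> {1..m}" for j
      using assms(2) that by (auto simp: 1(1) polygon_with_points_def polygon_def)
    \<comment> \<open>Menelaus is applied to \<open>A p\<close>, \<open>A i\<close>,
      \<open>A s\<close>: as \<open>i\<close> succeeds \<open>p\<close>, the old sides
      \<open>p\<close> and \<open>i\<close> meet at \<open>A i\<close>.\<close>
    have "X \<in> line_through (A p) (A s)" "X \<noteq> A s"
      and quot: "oriented_quotient (A p) X X (A s) = - (f p * f i)"
      using menelaus_quotient[OF 1(5)[folded p_def s_def], of "A i"]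
        on[OF cyc(6)] on[OF 1(4)]
      by (simp_all add: cyc(5) s_def f_def)
    then have "?B j \<in> line_through (?A j) (?A (cyc_succ (m - 1) j)) \<and>
        ?B j \<noteq> ?A (cyc_succ (m - 1) j)" if "j \<in> {1..m - 1}" for j
      using that on[OF skip_in[OF that]] cyc
      by (cases "j = k") (simp_all add: A B Bk)
    then have "polygon_with_points T"
      using 1(6) by (simp add: 1(2) polygon_with_points_def)
    moreover have "prod g {1..m - 1} = - prod f {1..m}"
    proof -
      have "prod g {1..m - 1} = g k * prod g ({1..m - 1} - {k})"
        using cyc(1) by (simp add: prod.remove)
      also have "g k = - f i * f (skip i k)"
        using quot by (simp add: g_def A Bk cyc(2,3) del: One_nat_def)
      also have "prod g ({1..m - 1} - {k}) = (\<Prod>j\<in>{1..m - 1} - {k}. f (skip i j))"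
        by (rule prod.cong) (simp_all add: g_def f_def A B cyc(4) del: One_nat_def)
      \<comment> \<open>The factor at \<open>skip i k = p\<close> is put back to complete the index
        range. Reindexing by \<open>skip i\<close> then omits exactly index \<open>i\<close>, whose
        factor \<open>f i\<close> stands in front.\<close>
      also have "- f i * f (skip i k) * \<dots> = - f i * (\<Prod>j = 1..m - 1. f (skip i j))"
        using cyc(1) by (simp add: prod.remove)
      also have "(\<Prod>j = 1..m - 1. f (skip i j)) = prod f ({1..m} - {i})"
        by (rule prod.reindex_bij_betw[OF bij_betw_skip[OF 1(4)]])
      also have "- f i * \<dots> = - prod f {1..m}"
        using 1(4) by (simp add: prod.remove)
      finally show ?thesis .
    qed
    then have "quotient_product T = - quotient_product S"
      by (simp add: 1(1,2) quotient_product_def f_def g_def)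
    ultimately show ?thesis by (simp add: 1(1,2))
  qed
  then show "polygon_with_points T" "quotient_product T = - quotient_product S"
    "fst T = fst S - 1" by auto
qed

lemma reduction_steps_invariant:
  assumes "(reduction_step ^^ k) S T" "polygon_with_points S"
  shows "polygon_with_points T \<and> quotient_product T = (-1) ^ k * quotient_product S \<and>
    fst T = fst S - k"
  using assms(1)
proof (induction k arbitrary: T)
  case 0
  then show ?case using assms(2) by simp
next
  case (Suc k)
  then obtain U where "(reduction_step ^^ k) S U" "reduction_step U T" by auto
  with Suc.IH[of U] reduction_step_invariant[of U T] show ?case by simp
qed

section \<open>The final triangle and the conclusion\<close>

lemma collinear_triangle_iff:
  assumes "polygon_with_points T" "fst T = 3"
  shows "collinear_triangle T \<longleftrightarrow> quotient_product T = -1"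
proof -
  obtain A B where T: "T = (3, A, B)" using assms(2) by (cases T rule: prod_cases3) simp
  have I: "{1..3} = {1, 2, 3::nat}" by auto
  have poly: "polygon 3 A" using assms(1) by (simp add: T polygon_with_points_def)
  have "\<not> collinear {A 1, A 2, A 3}" using poly by (simp only: polygon_def I image_insert image_empty simp_thms)
  moreover have cyc: "cyc_succ 3 1 = 2" "cyc_succ 3 2 = 3" "cyc_succ 3 3 = 1"
    by (simp_all add: cyc_succ_def)
  ultimately have "collinear {B 1, B 2, B 3} \<longleftrightarrow>
      oriented_quotient (A 1) (B 1) (B 1) (A 2) * oriented_quotient (A 2) (B 2) (B 2) (A 3) *
      oriented_quotient (A 3) (B 3) (B 3) (A 1) = -1"
    using assms(1)
    by (intro menelaus_collinear_iff)
      (simp_all add: T polygon_with_points_def I del: One_nat_def)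
  with poly show ?thesis
    by (simp add: T quotient_product_def collinear_triangle_def I cyc mult.assoc
        del: One_nat_def)
qed

theorem theorem19:
  fixes n :: nat and A B :: "nat \<Rightarrow> real^2"
  assumes "3 \<le> n"
    and "polygon n A"
    and "\<And>i. i \<in> {1..n} \<Longrightarrow> B i \<in> line_through (A i) (A (cyc_succ n i))"
    and "\<And>i. i \<in> {1..n} \<Longrightarrow> B i \<noteq> A (cyc_succ n i)"
  shows "((\<exists>T. (reduction_step ^^ (n - 3)) (n, A, B) T \<and> collinear_triangle T) \<longrightarrow>
           (\<forall>T. (reduction_step ^^ (n - 3)) (n, A, B) T \<longrightarrow> collinear_triangle T)) \<and>
         ((\<exists>T. (reduction_step ^^ (n - 3)) (n, A, B) T) \<longrightarrow>
           ((\<exists>T. (reduction_step ^^ (n - 3)) (n, A, B) T \<and> collinear_triangle T) \<longleftrightarrow>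
            (\<Prod>i = 1..n. oriented_quotient (A i) (B i) (B i) (A (cyc_succ n i))) = (-1) ^ n))"
proof -
  define S where "S = (n, A, B)"
  have S: "polygon_with_points S" using assms by (simp add: S_def polygon_with_points_def)
  \<comment> \<open>\<open>n - 3\<close> and \<open>n\<close> have opposite parity.\<close>
  have sign: "(-1) ^ (n - 3) * q = -1 \<longleftrightarrow> q = (-1) ^ n" for q :: real
  proof -
    obtain k where "n = k + 3" using assms(1) by (metis le_add_diff_inverse2)
    then show ?thesis by (cases "even k") auto
  qed
  \<comment> \<open>The right-hand side does not mention \<open>T\<close>, so all triangles reached
    in \<open>n - 3\<close> steps agree on collinearity. Both claims follow.\<close>
  have "collinear_triangle T \<longleftrightarrow> quotient_product S = (-1) ^ n"
    if "(reduction_step ^^ (n - 3)) S T" for T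
  proof -
    from reduction_steps_invariant[OF that S]
    have "polygon_with_points T" "fst T = 3"
      and q: "quotient_product T = (-1) ^ (n - 3) * quotient_product S"
      using assms(1) by (auto simp: S_def)
    then have "collinear_triangle T \<longleftrightarrow> quotient_product T = -1"
      using collinear_triangle_iff by blast
    then show ?thesis by (simp only: q sign)
  qed
  then show ?thesis unfolding S_def quotient_product_def prod.case by blast
qed

end
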